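(* Let $M_x \ge 0$ and $M_h > 0$, and define for $t \ge 0$ $$L_x(t) = M_x \sqrt{\frac{1}{2 M_h}\left(e^{2M_h t} - 1\right)}, \qquad L_h(t) = e^{M_h t} - 1 .$$ Then the two classes of start-corrected differentially definable mappings $\mathring{\mathcal{F}}_g(M_x, M_h)$ (those whose vector field is $M_x, M_h$-Lipschitz) and $\mathring{\mathcal{F}}_F(L_x(\cdot), L_h(\cdot))$ (those which are themselves $L_x(t), L_h(t)$-Lipschitz at every time $t$) are equal: $$\mathring{\mathcal{F}}_g(M_x, M_h) = \mathring{\mathcal{F}}_F(L_x(\cdot), L_h(\cdot)).$$
   Context: Fix dimensions $u, v \ge 1$. Input trajectories are continuous functions $\mathbf{x}: [0,\infty) \to \mathbb{R}^u$. Norms are Euclidean. Differentially definable mappings $\mathcal{F}$: for a vector field $\mathbf{g}: \mathbb{R}^u \times \mathbb{R}^v \to \mathbb{R}^v$ such that for every input trajectory $\mathbf{x}$ and every $\mathbf{h}_0 \in \mathbb{R}^v$ the problem $\frac{d}{dt}\mathbf{h}(t) = \mathbf{g}(\mathbf{x}(t), \mathbf{h}(t))$, $\mathbf{h}(0) = \mathbf{h}_0$, has a unique solution $\mathbf{h}$ on $[0,\infty)$, put $F_{\mathbf{g}}(\mathbf{x}(\cdot), \mathbf{h}_0; t) = \mathbf{h}(t)$. $\mathcal{F}$ is the set of all such mappings $F_{\mathbf{g}}$. Start-corrected mappings: $\mathring{\mathcal{F}} = \{\mathring{F}_{\mathbf{g}} : F_{\mathbf{g}} \in \mathcal{F}\}$,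 where $\mathring{F}_{\mathbf{g}}(\mathbf{x}(\cdot), \mathbf{h}_0; t) = F_{\mathbf{g}}(\mathbf{x}(\cdot), \mathbf{h}_0; t) - \mathbf{h}_0$. $\mathring{\mathcal{F}}_g(M_x, M_h)$ is the set of $\mathring{F}_{\mathbf{g}} \in \mathring{\mathcal{F}}$ such that $\mathbf{g}$ is $M_x$-Lipschitz in its argument $\mathbf{x} \in \mathbb{R}^u$ (for every fixed $\mathbf{h}$) and $M_h$-Lipschitz in its argument $\mathbf{h} \in \mathbb{R}^v$ (for every fixed $\mathbf{x}$). For functions $L_x, L_h$ of time with nonnegative values, $\mathring{\mathcal{F}}_F(L_x(\cdot), L_h(\cdot))$ is the set of $\mathring{F}_{\mathbf{g}} \in \mathring{\mathcal{F}}$ such that for every $t \ge 0$, $\mathring{F}_{\mathbf{g}}(\cdot, \cdot; t)$ is $L_x(t)$-Lipschitz in the trajectory and $L_h(t)$-Lipschitz in the initial state, i.e. for all trajectories $\mathbf{x}, \mathbf{x}_1, \mathbf{x}_2$ and all $\mathbf{h}_0, \mathbf{h}_1, \mathbf{h}_2 \in \mathbb{R}^v$, $$\|\mathring{F}_{\mathbf{g}}(\mathbf{x}_1, \mathbf{h}_0; t) - \mathring{F}_{\mathbf{g}}(\mathbf{x}_2, \mathbf{h}_0; t)\| \le L_x(t)\, \rho_t(\mathbf{x}_1, \mathbf{x}_2), \qquad \|\mathring{F}_{\mathbf{g}}(\mathbf{x}, \mathbf{h}_1; t) - \mathring{F}_{\mathbf{g}}(\mathbf{x}, \mathbf{h}_2;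 t)\| \le L_h(t)\, \|\mathbf{h}_1 - \mathbf{h}_2\|,$$ where $\rho_t(\mathbf{x}_1, \mathbf{x}_2) = \left(\int_0^t \|\mathbf{x}_1(\tau) - \mathbf{x}_2(\tau)\|^2 d\tau\right)^{1/2}$. *)

theory Defs
  imports "HOL-Analysis.Analysis"
begin

text \<open>
  Partial functions with a fixed domain are represented as total functions that are
  \<open>extensional\<close> on that domain. Hence two trajectories, or two mappings, are equal in HOL iff
  they agree on \<open>[0, \<infinity>)\<close>, respectively on \<open>mapping_domain\<close>; values at negative times play no role.
\<close>

definition trajectories :: "(real \<Rightarrow> real ^ 'u) set" where
  "trajectories = {x \<in> extensional {0..}. continuous_on {0..} x}"

type_synonym ('u, 'v) vector_field = "real ^ 'u \<Rightarrow> real ^ 'v \<Rightarrow> real ^ 'v"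

text \<open>Arguments: input trajectory, initial state, time.\<close>
type_synonym ('u, 'v) mapping = "(real \<Rightarrow> real ^ 'u) \<times> (real ^ 'v) \<times> real \<Rightarrow> real ^ 'v"

definition mapping_domain :: "((real \<Rightarrow> real ^ 'u) \<times> (real ^ 'v) \<times> real) set" where
  "mapping_domain = trajectories \<times> UNIV \<times> {0..}"

text \<open>The derivative is one-sided at time \<open>0\<close>.\<close>
definition is_solution ::
  "('u::finite, 'v::finite) vector_field \<Rightarrow> (real \<Rightarrow> real ^ 'u) \<Rightarrow> real ^ 'v \<Rightarrow> (real \<Rightarrow> real ^ 'v) \<Rightarrow> bool" where
  "is_solution g x h0 h \<longleftrightarrow>
     h \<in> extensional {0..} \<and> h 0 = h0 \<and>
     (\<forall>t\<ge>0. (h has_vector_derivative g (x t) (h t)) (at t within {0..}))"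

definition well_posed :: "('u::finite, 'v::finite) vector_field \<Rightarrow> bool" where
  "well_posed g \<longleftrightarrow> (\<forall>x\<in>trajectories. \<forall>h0. \<exists>!h. is_solution g x h0 h)"

definition solution_map :: "('u::finite, 'v::finite) vector_field \<Rightarrow> ('u, 'v) mapping" where
  "solution_map g = (\<lambda>(x, h0, t)\<in>mapping_domain. (THE h. is_solution g x h0 h) t)"

definition differentially_definable :: "('u::finite, 'v::finite) mapping set" where
  "differentially_definable = {solution_map g | g. well_posed g}"

definition start_correct :: "('u::finite, 'v::finite) mapping \<Rightarrow> ('u, 'v) mapping" where
  "start_correct F = (\<lambda>(x, h0, t)\<in>mapping_domain. F (x, h0, t) - h0)"

definition start_corrected :: "('u::finite, 'v::finite) mapping set" where
  "start_corrected = start_correct ` differentially_definable"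

definition lipschitz_field_class :: "real \<Rightarrow> real \<Rightarrow> ('u::finite, 'v::finite) mapping set" where
  "lipschitz_field_class M\<^sub>x M\<^sub>h =
     {start_correct (solution_map g) | g. well_posed g \<and>
        (\<forall>h. M\<^sub>x-lipschitz_on UNIV (\<lambda>x. g x h)) \<and>
        (\<forall>x. M\<^sub>h-lipschitz_on UNIV (\<lambda>h. g x h))}"

definition traj_dist :: "real \<Rightarrow> (real \<Rightarrow> real ^ 'u) \<Rightarrow> (real \<Rightarrow> real ^ 'u) \<Rightarrow> real" where
  "traj_dist t x1 x2 = sqrt (integral {0..t} (\<lambda>\<tau>. (norm (x1 \<tau> - x2 \<tau>))\<^sup>2))"

definition lipschitz_mapping_class ::
  "(real \<Rightarrow> real) \<Rightarrow> (real \<Rightarrow> real) \<Rightarrow> ('u::finite, 'v::finite) mapping set" where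
  "lipschitz_mapping_class L\<^sub>x L\<^sub>h =
     {F \<in> start_corrected. \<forall>t\<ge>0.
        (\<forall>x1\<in>trajectories. \<forall>x2\<in>trajectories. \<forall>h0.
           norm (F (x1, h0, t) - F (x2, h0, t)) \<le> L\<^sub>x t * traj_dist t x1 x2) \<and>
        (\<forall>x\<in>trajectories. \<forall>h1 h2.
           norm (F (x, h1, t) - F (x, h2, t)) \<le> L\<^sub>h t * norm (h1 - h2))}"

end

theory Submission imports Defs "HOL-Real_Asymp.Real_Asymp" begin

text \<open>
  For \<open>\<subseteq>\<close>, the difference \<open>e\<close> of two solutions satisfies
  \<open>\<parallel>e'\<parallel> \<le> M\<^sub>h \<parallel>e\<parallel> + M\<^sub>x \<parallel>x\<^sub>1 - x\<^sub>2\<parallel>\<close>; Gronwall's inequality for \<open>e - e(0)\<close> followed by the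
  Cauchy-Schwarz inequality gives exactly the functions \<open>L\<^sub>x\<close> and \<open>L\<^sub>h\<close>.
  For \<open>\<supseteq>\<close>, the vector field is recovered as the derivative at time \<open>0\<close> of the mapping along
  constant trajectories, and \<open>L\<^sub>x(t) \<surd>t / t \<rightarrow> M\<^sub>x\<close>, \<open>L\<^sub>h(t) / t \<rightarrow> M\<^sub>h\<close> as \<open>t \<rightarrow> 0\<close>.
\<close>

section \<open>Integral inequalities\<close>

text \<open>The integral \<open>u\<close> of the bound dominates \<open>norm (e t - e 0)\<close> and
  grows no faster than \<open>M * (norm (e 0) + u) + b\<close>, so an integrating factor applies.
  Estimating the increment rather than \<open>e\<close> itself yields the factor
  \<open>exp (M * T) - 1\<close> that start correction requires.\<close>

lemma gronwall_increment:
  fixes e e' :: "real \<Rightarrow> 'a::real_normed_vector" and b :: "real \<Rightarrow> real"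
  assumes "T \<ge> 0" "M \<ge> 0"
    and e: "\<And>t. t \<in> {0..T} \<Longrightarrow> (e has_vector_derivative e' t) (at t within {0..T})"
    and b: "continuous_on {0..T} b"
    and bound: "\<And>t. t \<in> {0..T} \<Longrightarrow> norm (e' t) \<le> M * norm (e t) + b t"
  shows "norm (e T - e 0) \<le>
    (exp (M * T) - 1) * norm (e 0) + exp (M * T) * integral {0..T} (\<lambda>\<tau>. exp (- M * \<tau>) * b \<tau>)"
proof -
  define u where "u t = integral {0..t} (\<lambda>\<tau>. M * norm (e \<tau>) + b \<tau>)" for t
  define w where "w t = integral {0..t} (\<lambda>\<tau>. exp (- M * \<tau>) * b \<tau>)" for t
  \<comment> \<open>The integrating factor makes \<open>q\<close> nonincreasing: the
    \<open>b\<close> terms cancel against \<open>w\<close>, leaving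
    \<open>q' = - exp (- M * t) * M * (norm (e 0) + u t - norm (e t))\<close>, and
    \<open>q 0 = norm (e 0)\<close>.\<close>
  define q where "q t = exp (- M * t) * (norm (e 0) + u t) - w t" for t
  have e_cont: "continuous_on {0..T} e"
    using e has_vector_derivative_continuous continuous_on_eq_continuous_within by blast
  have u: "(u has_real_derivative M * norm (e t) + b t) (at t within {0..T})"
    if "t \<in> {0..T}" for t
    unfolding u_def using that
    by (intro integral_has_real_derivative continuous_intros e_cont b)
  have w: "(w has_real_derivative exp (- M * t) * b t) (at t within {0..T})"
    if "t \<in> {0..T}" for t
    unfolding w_def using that by (intro integral_has_real_derivative continuous_intros b)
  have u_cont: "continuous_on {0..T} u" and w_cont: "continuous_on {0..T} w"
    using DERIV_continuous_on[OF u] DERIV_continuous_on[OF w] by auto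
  have at: "at t within {0..T} = at t" if "0 < t" "t < T" for t
    using that by (intro at_within_interior) simp
  have incr: "norm (e t - e 0) \<le> u t" if "t \<in> {0..T}" for t
  proof (cases "t = 0")
    case True
    then show ?thesis by (simp add: u_def)
  next
    case False
    have "norm (e t - e 0) \<le> u t - u 0"
    proof (rule differentiable_bound_general)
      show "0 < t" using False that by simp
      show "continuous_on {0..t} e" "continuous_on {0..t} u"
        using that by (auto intro: continuous_on_subset[OF e_cont] continuous_on_subset[OF u_cont])
      fix s assume s: "0 < s" "s < t"
      then have s': "s \<in> {0..T}" and "at s within {0..T} = at s" using that at by auto
      then show "(e has_vector_derivative e' s) (at s)"
        and "(u has_vector_derivative M * norm (e s) + b s) (at s)"
        and "norm (e' s) \<le> M * norm (e s) + b s"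
        using e[OF s'] u[OF s'] bound[OF s']
        by (auto simp: has_real_derivative_iff_has_vector_derivative)
    qed
    then show ?thesis by (simp add: u_def)
  qed
  have "- q 0 \<le> - q T"
  proof (rule DERIV_nonneg_imp_increasing_open[where f = "\<lambda>t. - q t"])
    show "continuous_on {0..T} (\<lambda>t. - q t)"
      unfolding q_def by (intro continuous_intros u_cont w_cont)
    fix t assume t: "0 < t" "t < T"
    then have t': "t \<in> {0..T}" by simp
    have "(u has_real_derivative M * norm (e t) + b t) (at t)"
      "(w has_real_derivative exp (- M * t) * b t) (at t)"
      using u[OF t'] w[OF t'] at[OF t] by auto
    then have "((\<lambda>t. - q t) has_real_derivative
        exp (- M * t) * M * (norm (e 0) + u t - norm (e t))) (at t)"
      unfolding q_def by (auto intro!: derivative_eq_intros simp: algebra_simps)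
    moreover have "0 \<le> exp (- M * t) * M * (norm (e 0) + u t - norm (e t))"
      using incr[OF t'] norm_triangle_ineq2[of "e t" "e 0"] \<open>M \<ge> 0\<close> by simp
    ultimately show "\<exists>y. ((\<lambda>t. - q t) has_real_derivative y) (at t) \<and> y \<ge> 0"
      by blast
  qed fact
  then have "exp (- M * T) * (norm (e 0) + u T) \<le> norm (e 0) + w T"
    by (simp add: q_def u_def w_def)
  then have "exp (M * T) * (exp (- M * T) * (norm (e 0) + u T)) \<le> exp (M * T) * (norm (e 0) + w T)"
    by (rule mult_left_mono) simp
  then have "norm (e 0) + u T \<le> exp (M * T) * (norm (e 0) + w T)"
    by (simp only: mult.assoc[symmetric] exp_add[symmetric]) simp
  with incr[of T] \<open>T \<ge> 0\<close> show ?thesis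
    by (simp add: w_def algebra_simps)
qed

text \<open>The integral of \<open>(r * f x - s * g x)\<^sup>2\<close> is a quadratic form in
  \<open>r\<close> and \<open>s\<close> that is never negative.\<close>

lemma Cauchy_Schwarz_integral:
  fixes f g :: "real \<Rightarrow> real"
  assumes f: "continuous_on {a..b} f" and g: "continuous_on {a..b} g"
  shows "integral {a..b} (\<lambda>x. f x * g x) \<le>
    sqrt (integral {a..b} (\<lambda>x. (f x)\<^sup>2)) * sqrt (integral {a..b} (\<lambda>x. (g x)\<^sup>2))"
proof -
  define F G C where "F = integral {a..b} (\<lambda>x. (f x)\<^sup>2)" and "G = integral {a..b} (\<lambda>x. (g x)\<^sup>2)"
    and "C = integral {a..b} (\<lambda>x. f x * g x)"
  have quad: "0 \<le> r\<^sup>2 * F - 2 * r * s * C + s\<^sup>2 * G" for r s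
  proof -
    have int: "(\<lambda>x. (f x)\<^sup>2) integrable_on {a..b}" "(\<lambda>x. (g x)\<^sup>2) integrable_on {a..b}"
      "(\<lambda>x. f x * g x) integrable_on {a..b}"
      by (intro integrable_continuous_real continuous_intros f g)+
    have "((\<lambda>x. r\<^sup>2 * (f x)\<^sup>2 - 2 * r * s * (f x * g x) + s\<^sup>2 * (g x)\<^sup>2) has_integral
        r\<^sup>2 * F - 2 * r * s * C + s\<^sup>2 * G) {a..b}"
      unfolding F_def G_def C_def
      by (intro has_integral_add has_integral_diff has_integral_mult_right integrable_integral int)
    moreover have "r\<^sup>2 * (f x)\<^sup>2 - 2 * r * s * (f x * g x) + s\<^sup>2 * (g x)\<^sup>2 = (r * f x - s * g x)\<^sup>2" for x
      by (simp add: power2_eq_square algebra_simps)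
    ultimately have "((\<lambda>x. (r * f x - s * g x)\<^sup>2) has_integral
        r\<^sup>2 * F - 2 * r * s * C + s\<^sup>2 * G) {a..b}"
      by (simp only:)
    then show ?thesis
      by (rule has_integral_nonneg) simp
  qed
  have "0 \<le> F" "0 \<le> G"
    using quad[of 1 0] quad[of 0 1] by auto
  have "C\<^sup>2 \<le> F * G"
  proof (cases "F = 0")
    case True
    have "C = 0"
    proof (rule ccontr)
      assume "C \<noteq> 0"
      \<comment> \<open>With \<open>F = 0\<close> the form is affine in \<open>r\<close>; this
        \<open>r\<close>, with \<open>s = 1\<close>, gives it the value \<open>-1\<close>.\<close>
      then show False
        using quad[of "(G + 1) / (2 * C)" 1] True by (simp add: field_simps)
    qed
    with True show ?thesis by simp
  next
    case False
    have "C\<^sup>2 * F - 2 * C * F * C + F\<^sup>2 * G = F * (F * G - C\<^sup>2)"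
      by (simp add: power2_eq_square algebra_simps)
    \<comment> \<open>For fixed \<open>s = F > 0\<close> the form is minimal at
      \<open>r = C\<close>.\<close>
    with quad[of C F] have "0 \<le> F * (F * G - C\<^sup>2)"
      by simp
    with False \<open>0 \<le> F\<close> show ?thesis
      by (simp add: zero_le_mult_iff)
  qed
  then show ?thesis
    using real_le_rsqrt by (fold F_def G_def C_def) (simp add: real_sqrt_mult[symmetric])
qed

text \<open>The first root on the right is the L2 norm over \<open>{0..T}\<close> of the Gronwall
  kernel \<open>exp (M * (T - \<tau>))\<close>; this is where \<open>L\<^sub>x\<close> comes
  from.\<close>

lemma integral_exp_weight_le:
  fixes d :: "real \<Rightarrow> real"
  assumes "T \<ge> 0" "M > 0" and d: "continuous_on {0..T} d"
  shows "exp (M * T) * integral {0..T} (\<lambda>\<tau>. exp (- M * \<tau>) * d \<tau>) \<le>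
    sqrt (1 / (2 * M) * (exp (2 * M * T) - 1)) * sqrt (integral {0..T} (\<lambda>\<tau>. (d \<tau>)\<^sup>2))"
proof -
  have "((\<lambda>\<tau>. (exp (- M * \<tau>))\<^sup>2) has_integral
      (- exp (- 2 * M * T) / (2 * M)) - (- exp (- 2 * M * 0) / (2 * M))) {0..T}"
  proof (rule fundamental_theorem_of_calculus)
    show "((\<lambda>\<tau>. - exp (- 2 * M * \<tau>) / (2 * M)) has_vector_derivative (exp (- M * \<tau>))\<^sup>2)
        (at \<tau> within {0..T})" for \<tau>
      unfolding has_real_derivative_iff_has_vector_derivative[symmetric] using \<open>M > 0\<close>
      by (auto intro!: derivative_eq_intros simp: exp_double[symmetric] algebra_simps)
  qed fact
  then have "integral {0..T} (\<lambda>\<tau>. (exp (- M * \<tau>))\<^sup>2) = (1 - exp (- 2 * M * T)) / (2 * M)"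
    by (simp add: integral_unique diff_divide_distrib)
  \<comment> \<open>As a root, the prefactor can be merged with the L2 norm of the weight.\<close>
  moreover have "exp (M * T) = sqrt (exp (2 * M * T))"
    using exp_double[of "M * T"] by (simp add: mult.assoc)
  ultimately have "exp (M * T) * sqrt (integral {0..T} (\<lambda>\<tau>. (exp (- M * \<tau>))\<^sup>2)) =
      sqrt (1 / (2 * M) * (exp (2 * M * T) - 1))"
    using \<open>M > 0\<close> by (simp add: real_sqrt_mult[symmetric] exp_minus divide_simps)
      (simp add: algebra_simps)
  moreover have "integral {0..T} (\<lambda>\<tau>. exp (- M * \<tau>) * d \<tau>) \<le>
      sqrt (integral {0..T} (\<lambda>\<tau>. (exp (- M * \<tau>))\<^sup>2)) * sqrt (integral {0..T} (\<lambda>\<tau>. (d \<tau>)\<^sup>2))"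
    by (intro Cauchy_Schwarz_integral continuous_intros d)
  ultimately show ?thesis
    using mult_left_mono[OF _ exp_ge_zero[of "M * T"]] by (metis (no_types) mult.assoc)
qed

section \<open>From increments to derivatives at time 0\<close>

text \<open>The difference quotient \<open>(f t - f 0) /\<^sub>R t\<close> tends to
  \<open>f'\<close> and is bounded by \<open>B t / t\<close>, so only the first-order behaviour of
  \<open>B\<close> at 0 matters.\<close>

lemma norm_vector_derivative_le_limit:
  fixes f :: "real \<Rightarrow> 'a::real_normed_vector"
  assumes f: "(f has_vector_derivative f') (at 0 within {0..})"
    and bound: "\<And>t. t > 0 \<Longrightarrow> norm (f t - f 0) \<le> B t"
    and B: "((\<lambda>t. B t / t) \<longlongrightarrow> C) (at_right 0)"
  shows "norm f' \<le> C"
proof -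
  let ?r = "\<lambda>t. (f t - f 0 - t *\<^sub>R f') /\<^sub>R t"
  have "(f has_vector_derivative f') (at_right 0)"
    using f by (rule has_vector_derivative_within_subset) auto
  then have "((\<lambda>t. (f t - f 0 - t *\<^sub>R f') /\<^sub>R \<bar>t\<bar>) \<longlongrightarrow> 0) (at_right 0)"
    by (simp add: has_vector_derivative_def has_derivative_within diff_diff_eq divide_inverse)
  then have "(?r \<longlongrightarrow> 0) (at_right 0)"
    by (rule Lim_transform_eventually) (simp add: eventually_at_filter)
  then have lim: "((\<lambda>t. B t / t + norm (?r t)) \<longlongrightarrow> C + norm (0::'a)) (at_right 0)"
    by (intro tendsto_add B tendsto_norm)
  have "norm f' \<le> B t / t + norm (?r t)" if "t > 0" for t
  proof -
    have "f' = (f t - f 0) /\<^sub>R t - ?r t"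
      using that by (simp add: algebra_simps)
    then have "norm f' \<le> norm ((f t - f 0) /\<^sub>R t) + norm (?r t)"
      by (metis norm_triangle_ineq4)
    also have "norm ((f t - f 0) /\<^sub>R t) \<le> B t / t"
      using divide_right_mono[OF bound[OF that], of t] that by (simp add: divide_inverse mult.commute)
    finally show ?thesis by simp
  qed
  then have "\<forall>\<^sub>F t in at_right 0. norm f' \<le> B t / t + norm (?r t)"
    by (simp add: eventually_at_filter)
  with lim show ?thesis
    using tendsto_lowerbound trivial_limit_at_right_real by fastforce
qed

section \<open>Solutions and their dependence on the data\<close>

text \<open>Uniqueness resolves the \<open>THE\<close> in \<open>solution_map\<close>, so that
  mappings can be handled through actual solutions.\<close>

lemma start_correct_solution_map:
  fixes g :: "('u::finite, 'v::finite) vector_field"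
  assumes "well_posed g" "x \<in> trajectories"
  obtains h where "is_solution g x h0 h"
    and "\<And>t. t \<ge> 0 \<Longrightarrow> start_correct (solution_map g) (x, h0, t) = h t - h0"
proof -
  obtain h where h: "is_solution g x h0 h" and "\<And>k. is_solution g x h0 k \<Longrightarrow> k = h"
    using assms unfolding well_posed_def by metis
  then have "(THE h. is_solution g x h0 h) = h"
    by (rule the_equality)
  with assms(2) h show ?thesis
    by (intro that[of h]) (auto simp: start_correct_def solution_map_def mapping_domain_def)
qed

text \<open>One joint estimate serves both Lipschitz conditions: equal initial states remove the
  first term, equal trajectories the second.\<close>

lemma solution_difference_bound:
  fixes g :: "('u::finite, 'v::finite) vector_field"
  assumes "M\<^sub>x \<ge> 0" "M\<^sub>h > 0" "t \<ge> 0"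
    and gx: "\<And>h. M\<^sub>x-lipschitz_on UNIV (\<lambda>x. g x h)"
    and gh: "\<And>x. M\<^sub>h-lipschitz_on UNIV (\<lambda>h. g x h)"
    and x1: "x1 \<in> trajectories" and x2: "x2 \<in> trajectories"
    and k1: "is_solution g x1 h1 k1" and k2: "is_solution g x2 h2 k2"
  shows "norm ((k1 t - h1) - (k2 t - h2)) \<le> (exp (M\<^sub>h * t) - 1) * norm (h1 - h2) +
    M\<^sub>x * sqrt (1 / (2 * M\<^sub>h) * (exp (2 * M\<^sub>h * t) - 1)) * traj_dist t x1 x2"
proof -
  define d where "d \<tau> = norm (x1 \<tau> - x2 \<tau>)" for \<tau>
  have d: "continuous_on {0..t} d"
  proof -
    have "continuous_on {0..t} x1" "continuous_on {0..t} x2"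
      using x1 x2 continuous_on_subset[of "{0..}" _ "{0..t}"] by (auto simp: trajectories_def)
    then show ?thesis
      unfolding d_def by (intro continuous_intros)
  qed
  have "norm ((k1 t - k2 t) - (k1 0 - k2 0)) \<le> (exp (M\<^sub>h * t) - 1) * norm (k1 0 - k2 0) +
      exp (M\<^sub>h * t) * integral {0..t} (\<lambda>\<tau>. exp (- M\<^sub>h * \<tau>) * (M\<^sub>x * d \<tau>))"
  proof (rule gronwall_increment)
    fix s assume s: "s \<in> {0..t}"
    have "(k1 has_vector_derivative g (x1 s) (k1 s)) (at s within {0..t})"
      "(k2 has_vector_derivative g (x2 s) (k2 s)) (at s within {0..t})"
      using k1 k2 s by (auto simp: is_solution_def intro: has_vector_derivative_within_subset)
    then show "((\<lambda>s. k1 s - k2 s) has_vector_derivative g (x1 s) (k1 s) - g (x2 s) (k2 s))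
        (at s within {0..t})"
      by (rule has_vector_derivative_diff)
    \<comment> \<open>Passing through \<open>g (x1 s) (k2 s)\<close> changes one argument at a time,
      as the separate Lipschitz conditions require.\<close>
    have "norm (g (x1 s) (k1 s) - g (x1 s) (k2 s)) \<le> M\<^sub>h * norm (k1 s - k2 s)"
      "norm (g (x1 s) (k2 s) - g (x2 s) (k2 s)) \<le> M\<^sub>x * d s"
      using lipschitz_onD[OF gh] lipschitz_onD[OF gx] by (auto simp: dist_norm d_def)
    then show "norm (g (x1 s) (k1 s) - g (x2 s) (k2 s)) \<le> M\<^sub>h * norm (k1 s - k2 s) + M\<^sub>x * d s"
      by (rule norm_diff_triangle_le)
  qed (use assms in \<open>auto intro!: continuous_intros d\<close>)
  also have "(\<lambda>\<tau>. exp (- M\<^sub>h * \<tau>) * (M\<^sub>x * d \<tau>)) = (\<lambda>\<tau>. M\<^sub>x * (exp (- M\<^sub>h * \<tau>) * d \<tau>))"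
    by (simp add: mult.left_commute)
  also have "exp (M\<^sub>h * t) * integral {0..t} \<dots> =
      M\<^sub>x * (exp (M\<^sub>h * t) * integral {0..t} (\<lambda>\<tau>. exp (- M\<^sub>h * \<tau>) * d \<tau>))"
    by simp
  also have "\<dots> \<le> M\<^sub>x * (sqrt (1 / (2 * M\<^sub>h) * (exp (2 * M\<^sub>h * t) - 1)) * traj_dist t x1 x2)"
    unfolding traj_dist_def d_def[symmetric]
    by (intro mult_left_mono integral_exp_weight_le d assms)
  finally show ?thesis
    using k1 k2 by (simp add: is_solution_def algebra_simps)
qed

section \<open>Recovering the vector field from constant trajectories\<close>

text \<open>Restricted to \<open>{0..}\<close> because trajectories are extensional there.\<close>

definition const_traj :: "real ^ 'u \<Rightarrow> real \<Rightarrow> real ^ 'u" where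
  "const_traj a = (\<lambda>t\<in>{0..}. a)"

lemma const_traj_trajectories: "const_traj a \<in> trajectories"
proof -
  have "continuous_on {0..} (const_traj a) \<longleftrightarrow> continuous_on {0..} (\<lambda>_::real. a)"
    by (rule continuous_on_cong) (auto simp: const_traj_def)
  then show ?thesis by (simp add: trajectories_def const_traj_def)
qed

text \<open>The factor \<open>sqrt t\<close> complements \<open>L\<^sub>x t\<close>, itself of order
  \<open>sqrt t\<close>, to a bound of first order in \<open>t\<close>.\<close>

lemma traj_dist_const_traj:
  assumes "t \<ge> 0"
  shows "traj_dist t (const_traj a) (const_traj b) = sqrt t * norm (a - b)"
proof -
  have "integral {0..t} (\<lambda>\<tau>. (norm (const_traj a \<tau> - const_traj b \<tau>))\<^sup>2) =
      integral {0..t} (\<lambda>\<tau>. (norm (a - b))\<^sup>2)"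
    by (rule integral_cong) (auto simp: const_traj_def)
  with assms show ?thesis by (simp add: traj_dist_def real_sqrt_mult)
qed

text \<open>Along \<open>const_traj a\<close> the solution from \<open>h\<close> has derivative
  \<open>g a h\<close> at time 0, so a bound on the mapping that is of first order in
  \<open>t\<close> passes to \<open>g\<close>.\<close>

lemma vector_field_difference_bound:
  fixes g :: "('u::finite, 'v::finite) vector_field"
  assumes "well_posed g"
    and bound: "\<And>t. t > 0 \<Longrightarrow> norm (start_correct (solution_map g) (const_traj a1, h1, t) -
      start_correct (solution_map g) (const_traj a2, h2, t)) \<le> B t"
    and B: "((\<lambda>t. B t / t) \<longlongrightarrow> C) (at_right 0)"
  shows "norm (g a1 h1 - g a2 h2) \<le> C"
proof -
  obtain k1 where k1: "is_solution g (const_traj a1) h1 k1"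
    "\<And>t. t \<ge> 0 \<Longrightarrow> start_correct (solution_map g) (const_traj a1, h1, t) = k1 t - h1"
    using start_correct_solution_map[OF \<open>well_posed g\<close> const_traj_trajectories] by blast
  obtain k2 where k2: "is_solution g (const_traj a2) h2 k2"
    "\<And>t. t \<ge> 0 \<Longrightarrow> start_correct (solution_map g) (const_traj a2, h2, t) = k2 t - h2"
    using start_correct_solution_map[OF \<open>well_posed g\<close> const_traj_trajectories] by blast
  have 0: "k1 0 = h1" "k2 0 = h2"
    using k1(1) k2(1) by (auto simp: is_solution_def)
  have "(k1 has_vector_derivative g (const_traj a1 0) (k1 0)) (at 0 within {0..})"
    "(k2 has_vector_derivative g (const_traj a2 0) (k2 0)) (at 0 within {0..})"
    using k1(1) k2(1) by (auto simp: is_solution_def)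
  then have "((\<lambda>t. k1 t - k2 t) has_vector_derivative g a1 h1 - g a2 h2) (at 0 within {0..})"
    by (auto simp: 0 const_traj_def intro: has_vector_derivative_diff)
  moreover have "norm ((k1 t - k2 t) - (k1 0 - k2 0)) \<le> B t" if "t > 0" for t
    using bound[OF that] k1(2) k2(2) that by (simp add: 0 algebra_simps)
  ultimately show ?thesis
    using B by (rule norm_vector_derivative_le_limit)
qed

section \<open>Equality of the two classes\<close>

theorem theorem3p1:
  fixes M\<^sub>x M\<^sub>h :: real
  assumes "M\<^sub>x \<ge> 0" and "M\<^sub>h > 0"
  shows "(lipschitz_field_class M\<^sub>x M\<^sub>h :: ('u::finite, 'v::finite) mapping set) =
    lipschitz_mapping_class
      (\<lambda>t. M\<^sub>x * sqrt (1 / (2 * M\<^sub>h) * (exp (2 * M\<^sub>h * t) - 1)))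
      (\<lambda>t. exp (M\<^sub>h * t) - 1)"
  (is "_ = lipschitz_mapping_class ?Lx ?Lh")
proof (intro subset_antisym subsetI)
  fix F :: "('u, 'v) mapping"
  assume "F \<in> lipschitz_field_class M\<^sub>x M\<^sub>h"
  then obtain g :: "('u, 'v) vector_field" where F: "F = start_correct (solution_map g)"
    and g: "well_posed g"
    and gx: "\<And>h. M\<^sub>x-lipschitz_on UNIV (\<lambda>x. g x h)"
    and gh: "\<And>x. M\<^sub>h-lipschitz_on UNIV (\<lambda>h. g x h)"
    by (auto simp: lipschitz_field_class_def)
  have bound: "norm (F (x1, h1, t) - F (x2, h2, t)) \<le>
      ?Lh t * norm (h1 - h2) + ?Lx t * traj_dist t x1 x2"
    if "t \<ge> 0" and x: "x1 \<in> trajectories" "x2 \<in> trajectories" for t x1 x2 h1 h2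
  proof -
    obtain k1 where k1: "is_solution g x1 h1 k1" "F (x1, h1, t) = k1 t - h1"
      using start_correct_solution_map[OF g x(1)] \<open>t \<ge> 0\<close> F by metis
    obtain k2 where k2: "is_solution g x2 h2 k2" "F (x2, h2, t) = k2 t - h2"
      using start_correct_solution_map[OF g x(2)] \<open>t \<ge> 0\<close> F by metis
    show ?thesis
      unfolding k1(2) k2(2)
      using assms \<open>t \<ge> 0\<close> gx gh x k1(1) k2(1) by (rule solution_difference_bound)
  qed
  have "F \<in> start_corrected"
    using F g by (auto simp: start_corrected_def differentially_definable_def)
  moreover have "norm (F (x1, h0, t) - F (x2, h0, t)) \<le> ?Lx t * traj_dist t x1 x2"
    if "t \<ge> 0" "x1 \<in> trajectories" "x2 \<in> trajectories" for t x1 x2 h0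
    using bound[OF that, of h0 h0] by simp
  moreover have "norm (F (x, h1, t) - F (x, h2, t)) \<le> ?Lh t * norm (h1 - h2)"
    if "t \<ge> 0" "x \<in> trajectories" for t x h1 h2
    \<comment> \<open>A trajectory has distance 0 from itself, so the \<open>?Lx\<close> term
      vanishes.\<close>
    using bound[OF that(1) that(2) that(2), of h1 h2] by (simp add: traj_dist_def)
  ultimately show "F \<in> lipschitz_mapping_class ?Lx ?Lh"
    unfolding lipschitz_mapping_class_def by blast
next
  fix F :: "('u, 'v) mapping"
  assume FL: "F \<in> lipschitz_mapping_class ?Lx ?Lh"
  \<comment> \<open>Any well-posed \<open>g\<close> representing \<open>F\<close> will do, since the
    mapping determines the values of \<open>g\<close> as derivatives at time 0.\<close>
  then obtain g :: "('u, 'v) vector_field" where F: "F = start_correct (solution_map g)"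
    and g: "well_posed g"
    by (auto simp: lipschitz_mapping_class_def start_corrected_def differentially_definable_def)
  have "norm (g a1 h - g a2 h) \<le> M\<^sub>x * norm (a1 - a2)" for a1 a2 h
  proof (rule vector_field_difference_bound[OF g])
    show "norm (start_correct (solution_map g) (const_traj a1, h, t) -
        start_correct (solution_map g) (const_traj a2, h, t)) \<le>
        ?Lx t * (sqrt t * norm (a1 - a2))" if "t > 0" for t
    proof -
      have "norm (F (const_traj a1, h, t) - F (const_traj a2, h, t)) \<le>
          ?Lx t * traj_dist t (const_traj a1) (const_traj a2)"
        using FL that unfolding lipschitz_mapping_class_def
        by (blast intro: const_traj_trajectories less_imp_le)
      then show ?thesis
        using that by (simp only: F traj_dist_const_traj less_imp_le)
    qed
    \<comment> \<open>As t tends to 0, the first root is asymptotic to \<open>sqrt t\<close>.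
      Multiplying by \<open>M\<^sub>x * norm (a1 - a2)\<close> only afterwards also covers the case
      where this factor is 0.\<close>
    have "((\<lambda>t. sqrt (1 / (2 * M\<^sub>h) * (exp (2 * M\<^sub>h * t) - 1)) * sqrt t / t) \<longlongrightarrow> 1) (at_right 0)"
      using \<open>M\<^sub>h > 0\<close> by real_asymp
    from tendsto_mult_left[OF this, of "M\<^sub>x * norm (a1 - a2)"]
    show "((\<lambda>t. ?Lx t * (sqrt t * norm (a1 - a2)) / t) \<longlongrightarrow> M\<^sub>x * norm (a1 - a2)) (at_right 0)"
      by (simp add: mult_ac)
  qed
  moreover have "norm (g a h1 - g a h2) \<le> M\<^sub>h * norm (h1 - h2)" for a h1 h2
  proof (rule vector_field_difference_bound[OF g])
    show "norm (start_correct (solution_map g) (const_traj a, h1, t) -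
        start_correct (solution_map g) (const_traj a, h2, t)) \<le> ?Lh t * norm (h1 - h2)"
      if "t > 0" for t
      using FL that unfolding lipschitz_mapping_class_def F[symmetric]
      by (blast intro: const_traj_trajectories less_imp_le)
    \<comment> \<open>This limit is the derivative of \<open>exp (M\<^sub>h * t)\<close> at
      0.\<close>
    have "((\<lambda>t. (exp (M\<^sub>h * t) - 1) / t) \<longlongrightarrow> M\<^sub>h) (at_right 0)"
      using \<open>M\<^sub>h > 0\<close> by real_asymp
    from tendsto_mult_right[OF this, of "norm (h1 - h2)"]
    show "((\<lambda>t. ?Lh t * norm (h1 - h2) / t) \<longlongrightarrow> M\<^sub>h * norm (h1 - h2)) (at_right 0)"
      by simp
  qed
  ultimately show "F \<in> lipschitz_field_class M\<^sub>x M\<^sub>h"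
    unfolding lipschitz_field_class_def mem_Collect_eq using F g assms
    by (intro exI[of _ g] conjI allI lipschitz_onI) (auto simp: dist_norm)
qed

end
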